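(* Let $n\ge 2$ be an integer with prime factorization $n=p_1^{\alpha_1}\cdots p_k^{\alpha_k}$, where $p_1<p_2<\cdots<p_k$ are primes and $\alpha_i\ge 1$. Let $D_n$ be the set of divisors $d$ of $n$ with $1\le d<n$, and let $\overline{D}_{p_1}=\{d\in D_n : p_1\nmid d\}$. Let $D\subseteq D_n$ be such that the integral circulant graph $\mathrm{ICG}_n(D)$ is connected and its complement is also connected. Then for every $1\le j\le n$, $$\lambda_j(n,D)\ \ge\ -\frac{n}{p_1}+p_1^{\alpha_1-1}.$$ Equality is satisfied in the following cases: (i) $n$ is arbitrary, $D=\overline{D}_{p_1}\setminus\left\{\frac{n}{p_1^{\alpha_1}}\right\}$ and $\frac{n}{p_1}\mid j$, for $1\le j\le n-1$; (ii) $n=2^{\alpha_1}\cdot 3$, $D=\{2,4,\ldots,2^{\alpha_1},3\}$, $2^{\alpha_1-1}\parallel j$ and $3\nmid j$, for $1\le j\le n-1$.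
   Context: For $D\subseteq D_n$, the integral circulant graph $\mathrm{ICG}_n(D)$ has vertex set $\mathbb{Z}_n=\{0,1,\ldots,n-1\}$, with $a$ and $b$ adjacent if and only if $\gcd(a-b,n)\in D$. Its complement is $\mathrm{ICG}_n(D_n\setminus D)$. The eigenvalues of its adjacency matrix are indexed as $$\lambda_j(n,D)=\sum_{d\in D} c\left(j,\tfrac{n}{d}\right)$$ (with $0\le j\le n-1$; the same formula is used for $j=n$ and gives $\lambda_n=\lambda_0$), where, for a positive integer $m$ and an integer $j\ge 0$, $$c(j,m)=\mu(t_{m,j})\frac{\varphi(m)}{\varphi(t_{m,j})},\qquad t_{m,j}=\frac{m}{\gcd(m,j)},$$ with $\mu$ the Möbius function, $\varphi$ Euler's totient function, and $\gcd(m,0)=m$. The notation $p^{a}\parallel j$ means $p^a\mid j$ and $p^{a+1}\nmid j$. *)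

theory Defs
  imports
    Complex_Main
    "HOL-Computational_Algebra.Squarefree"
    "HOL-Number_Theory.Totient"
    "Graph_Theory.Digraph_Component"
begin

text \<open>
  Graphs are symmetric, loop-free pair digraphs; connectedness is \<^const>\<open>Digraph_Component.connected\<close>,
  written with a qualified name because \<^theory>\<open>Complex_Main\<close> has a topological constant of the
  same base name.
\<close>

definition proper_divisors :: "nat \<Rightarrow> nat set" where
  "proper_divisors n = {d. d dvd n \<and> 1 \<le> d \<and> d < n}"

definition ICG :: "nat \<Rightarrow> nat set \<Rightarrow> int pair_pre_digraph" where
  "ICG n D = \<lparr> pverts = {0..<int n},
     parcs = {(a, b). a \<in> {0..<int n} \<and> b \<in> {0..<int n} \<and> nat (gcd (a - b) (int n)) \<in> D} \<rparr>"

definition graph_complement :: "'a pair_pre_digraph \<Rightarrow> 'a pair_pre_digraph" where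
  "graph_complement G = \<lparr> pverts = pverts G,
     parcs = {(a, b). a \<in> pverts G \<and> b \<in> pverts G \<and> a \<noteq> b \<and> (a, b) \<notin> parcs G} \<rparr>"

lemma ICG_symmetric: "(a, b) \<in> parcs (ICG n D) \<Longrightarrow> (b, a) \<in> parcs (ICG n D)"
  unfolding ICG_def using gcd_neg1_int[of "a - b" "int n"] by simp

lemma ICG_loopfree: "D \<subseteq> proper_divisors n \<Longrightarrow> (a, a) \<notin> parcs (ICG n D)"
  by (auto simp: ICG_def proper_divisors_def)

lemma graph_complement_ICG:
  assumes "D \<subseteq> proper_divisors n"
  shows "graph_complement (ICG n D) = ICG n (proper_divisors n - D)"
proof -
  have mem: "nat (gcd (a - b) (int n)) \<in> proper_divisors n \<longleftrightarrow> a \<noteq> b"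
    if "a \<in> {0..<int n}" "b \<in> {0..<int n}" for a b
  proof
    assume "nat (gcd (a - b) (int n)) \<in> proper_divisors n"
    then show "a \<noteq> b" by (auto simp: proper_divisors_def)
  next
    assume "a \<noteq> b"
    have n: "int n > 0" using that by auto
    have pos: "gcd (a - b) (int n) > 0" using n by (simp add: gcd_pos_int)
    have "gcd (a - b) (int n) \<le> \<bar>a - b\<bar>" using \<open>a \<noteq> b\<close> by (simp add: gcd_le1_int zdvd_imp_le)
    moreover have "\<bar>a - b\<bar> < int n" using that by auto
    ultimately have "nat (gcd (a - b) (int n)) < n" using n by linarith
    moreover have "nat (gcd (a - b) (int n)) dvd n"
      using pos by (simp add: nat_dvd_iff)
    ultimately show "nat (gcd (a - b) (int n)) \<in> proper_divisors n"
      using pos unfolding proper_divisors_def mem_Collect_eq by linarith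
  qed
  have "n \<notin> proper_divisors n" by (simp add: proper_divisors_def)
  then show ?thesis
    unfolding graph_complement_def ICG_def by (auto simp: mem)
qed

definition moebius :: "nat \<Rightarrow> int" where
  "moebius n = (if squarefree n then (-1) ^ card (prime_factors n) else 0)"

text \<open>
  Ramanujan's sum in Hoelder's closed form; \<open>gcd m 0 = m\<close> covers \<open>j = 0\<close>.
  The eigenvalue of the adjacency matrix of \<open>ICG n D\<close> belonging to the character
  \<open>a \<mapsto> exp (2 \<pi> i j a / n)\<close> is the sum of these over \<open>d \<in> D\<close>, so the
  indices \<open>j = n\<close> and \<open>j = 0\<close> give the same value.
\<close>

definition ramanujan_sum :: "nat \<Rightarrow> nat \<Rightarrow> real" where
  "ramanujan_sum j m =
     (let t = m div gcd m j
      in real_of_int (moebius t) * real (totient m) / real (totient t))"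

definition ICG_eigenvalue :: "nat \<Rightarrow> nat set \<Rightarrow> nat \<Rightarrow> real" where
  "ICG_eigenvalue n D j = (\<Sum>d\<in>D. ramanujan_sum j (n div d))"

definition exactly_divides :: "nat \<Rightarrow> nat \<Rightarrow> nat \<Rightarrow> bool" where
  "exactly_divides p a j \<longleftrightarrow> p ^ a dvd j \<and> \<not> p ^ (a + 1) dvd j"

end

theory Submission
  imports Defs
begin

text \<open>
  Fix \<open>j\<close> and write \<open>c m\<close> for the Ramanujan sum \<open>ramanujan_sum j m\<close>.  An eigenvalue is a subsum of
  the sum of \<open>c m\<close> over the divisors \<open>m\<close> of \<open>n\<close>, so it is at least the sum of all the negative
  values, which is half the difference of the full sum \<open>Z n\<close> and the full sum of absolute values
  \<open>S n\<close> (\<open>ICG_eigenvalue_ge_sums\<close>).  Both \<open>Z\<close> and \<open>S\<close> are multiplicative in \<open>n\<close>.  For a prime power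
  \<open>q ^ a\<close> not dividing \<open>j\<close> and the exact power \<open>q ^ b\<close> of \<open>q\<close> in \<open>j\<close>, one has \<open>Z (q ^ a) = 0\<close> and
  \<open>S (q ^ a) = 2 * q ^ b\<close>; otherwise both are \<open>q ^ a\<close>.  So \<open>S n \<le> n\<close> always, and if \<open>n\<close> does not
  divide \<open>j\<close>, then \<open>Z n = 0\<close> and \<open>S n \<le> 2 * n / q\<close> for a prime \<open>q\<close> dividing \<open>n\<close>
  (\<open>sum_abs_ramanujan_le\<close>, \<open>sum_ramanujan_not_dvd\<close>).

  Write \<open>n = p ^ a * M\<close>, where \<open>p\<close> is the least prime of \<open>n\<close> and does not divide \<open>M\<close>.  The bound to
  prove is \<open>- p ^ (a - 1) * (M - 1)\<close>.  If \<open>M\<close> does not divide \<open>j\<close>, it follows from the estimate of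
  \<open>S M\<close> with a prime \<open>q > p\<close>.  If \<open>M\<close> divides \<open>j\<close> and already \<open>p ^ (a - 1)\<close> does not, the factor
  \<open>S (p ^ a)\<close> is small enough.  If \<open>n\<close> divides \<open>j\<close>, the eigenvalue is not negative.

  There remain the critical indices, the multiples of \<open>n div p\<close> that are not multiples of \<open>n\<close>.
  There the negative values add up to \<open>- p ^ (a - 1) * M\<close>, too little by \<open>p ^ (a - 1)\<close>, and
  connectedness is needed.  The negative values belong exactly to the divisors \<open>d\<close> of \<open>n\<close> that \<open>p\<close>
  does not divide.  As the complement is connected, it uses one of them
  (\<open>connected_ICG_not_all_dvd\<close>), so \<open>D\<close> misses a value of size at least \<open>p ^ (a - 1)\<close>
  (\<open>ICG_eigenvalue_critical_ge\<close>).  Equality holds when \<open>D\<close> takes all negative values but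
  that of \<open>d = M\<close>, whose size is \<open>p ^ (a - 1)\<close>, and nothing else.  The graph itself being
  connected excludes \<open>M = 1\<close>.

  For \<open>n = 2 ^ a * 3\<close> and an index \<open>j\<close> divisible by \<open>2 ^ (a - 1)\<close>, but neither by \<open>2 ^ a\<close> nor by
  \<open>3\<close>, the general estimate loses nothing: \<open>S n = 2 * 2 ^ a\<close>, twice the bound in absolute value, and
  the divisors \<open>d\<close> with negative value are exactly \<open>2, 4, ..., 2 ^ a\<close> and \<open>3\<close>.  This is the second
  case of equality.
\<close>

section \<open>Multiplicativity of Ramanujan sums\<close>

lemma gcd_mult_coprime:
  fixes a b j :: nat
  assumes "coprime a b"
  shows "gcd (a * b) j = gcd a j * gcd b j"
proof (rule dvd_antisym)
  have "coprime (gcd a j) (gcd b j)"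
    using assms by (meson coprime_divisors gcd_dvd1)
  then show "gcd a j * gcd b j dvd gcd (a * b) j"
    by (simp add: divides_mult mult_dvd_mono)
  obtain x y where xy: "gcd (a * b) j = x * y" "x dvd a" "y dvd b"
    using division_decomp[of "gcd (a * b) j" a b] by auto
  have "x dvd j" "y dvd j"
    by (metis dvd_mult_left dvd_mult_right gcd_dvd2 xy(1))+
  then show "gcd (a * b) j dvd gcd a j * gcd b j"
    using xy by (simp add: mult_dvd_mono)
qed

lemma moebius_mult_coprime:
  assumes "coprime a b"
  shows "moebius (a * b) = moebius a * moebius b"
proof (cases "a = 0 \<or> b = 0")
  case True
  then show ?thesis by (auto simp: moebius_def)
next
  case False
  have "squarefree (a * b) \<longleftrightarrow> squarefree a \<and> squarefree b"
    using assms squarefree_mult_coprime squarefree_multD by blast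
  moreover have "prime_factors a \<inter> prime_factors b = {}"
  proof (intro equals0I)
    fix q assume "q \<in> prime_factors a \<inter> prime_factors b"
    then have "q dvd a" "q dvd b" "prime q" by auto
    then show False using assms coprime_common_divisor not_prime_unit by blast
  qed
  then have "card (prime_factors (a * b)) = card (prime_factors a) + card (prime_factors b)"
    using False by (simp add: prime_factors_product card_Un_disjoint)
  ultimately show ?thesis by (simp add: moebius_def power_add)
qed

lemma moebius_prime: "prime q \<Longrightarrow> moebius q = -1"
  by (simp add: moebius_def squarefree_prime prime_factorization_prime)

lemma moebius_prime_power: "prime q \<Longrightarrow> e \<ge> 2 \<Longrightarrow> moebius (q ^ e) = 0"
  using squarefree_power_iff[of q e] not_prime_unit[of q] by (auto simp: moebius_def)

text \<open>
  In Hoelder's closed form, \<open>gcd m j\<close>, and with it \<open>m div gcd m j\<close>, splits along coprime factors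
  of \<open>m\<close>, and both \<^const>\<open>moebius\<close> and \<^const>\<open>totient\<close> are multiplicative.  This reduces all
  divisor sums below to prime powers.
\<close>

lemma ramanujan_sum_mult_coprime:
  assumes "coprime a b"
  shows "ramanujan_sum j (a * b) = ramanujan_sum j a * ramanujan_sum j b"
proof -
  define s t where "s = a div gcd a j" and "t = b div gcd b j"
  have st: "a * b div gcd (a * b) j = s * t"
    unfolding s_def t_def gcd_mult_coprime[OF assms] by (simp add: div_mult_div_if_dvd)
  have "s dvd a" "t dvd b"
    unfolding s_def t_def by (metis dvd_div_mult_self dvd_triv_left gcd_dvd1)+
  then have "coprime s t" using assms coprime_divisors by blast
  then show ?thesis using assms
    by (simp add: ramanujan_sum_def st s_def[symmetric] t_def[symmetric]
        moebius_mult_coprime totient_mult_coprime)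
qed

section \<open>Values at prime powers\<close>

text \<open>
  Here \<open>m div gcd m j = 1\<close>.  With the next three lemmas this gives every value at a prime power:
  if \<open>q ^ b\<close> is the exact power of \<open>q\<close> in \<open>j\<close>, the value at \<open>q ^ i\<close> is \<open>totient (q ^ i)\<close> for
  \<open>i \<le> b\<close>, then once \<open>- q ^ b\<close>, and \<open>0\<close> from \<open>i = b + 2\<close> on.
\<close>

lemma ramanujan_sum_dvd:
  assumes "m dvd j" "m > 0"
  shows "ramanujan_sum j m = real (totient m)"
  using assms by (simp add: ramanujan_sum_def gcd_nat.absorb1 moebius_def)

lemma gcd_prime_power:
  fixes q j :: nat
  assumes "prime q" "q ^ b dvd j" "\<not> q ^ Suc b dvd j" "b \<le> i"
  shows "gcd (q ^ i) j = q ^ b"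
proof -
  obtain e where e: "e \<le> i" "gcd (q ^ i) j = q ^ e"
    using divides_primepow_nat[OF assms(1)] by (meson gcd_dvd1)
  have "q ^ e dvd j" by (metis e(2) gcd_dvd2)
  then have "e \<le> b" using assms(3) by (meson not_less_eq_eq power_le_dvd)
  moreover have "q ^ b dvd q ^ e"
    using assms(2,4) e(2) by (metis gcd_greatest le_imp_power_dvd)
  then have "b \<le> e" using power_dvd_imp_le prime_gt_1_nat[OF assms(1)] by blast
  ultimately show ?thesis using e by simp
qed

lemma ramanujan_sum_prime_power_Suc:
  assumes "prime q" "q ^ b dvd j" "\<not> q ^ Suc b dvd j"
  shows "ramanujan_sum j (q ^ Suc b) = - (real q ^ b)"
proof -
  have "q ^ Suc b div gcd (q ^ Suc b) j = q"
    using gcd_prime_power[OF assms, of "Suc b"] assms(1) prime_gt_0_nat by auto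
  moreover have "real q - 1 > 0" using prime_gt_1_nat[OF assms(1)] by simp
  ultimately show ?thesis
    using assms(1) prime_gt_1_nat[OF assms(1)]
    by (simp add: ramanujan_sum_def moebius_prime totient_prime totient_prime_power_Suc of_nat_diff
        del: power_Suc)
qed

lemma ramanujan_sum_prime_power_eq_0:
  assumes "prime q" "q ^ b dvd j" "\<not> q ^ Suc b dvd j" "i \<ge> b + 2"
  shows "ramanujan_sum j (q ^ i) = 0"
proof -
  have "q ^ i div gcd (q ^ i) j = q ^ (i - b)"
    using gcd_prime_power[OF assms(1-3), of i] assms prime_gt_0_nat[OF assms(1)]
    by (simp add: power_diff)
  then show ?thesis
    using assms by (simp add: ramanujan_sum_def moebius_prime_power)
qed

section \<open>Divisor sums of Ramanujan sums\<close>

text \<open>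
  A divisor of \<open>a * b\<close> is uniquely a product of a divisor of \<open>a\<close> and a divisor of \<open>b\<close>.
  Multiplicativity is asked only for such pairs, which are coprime, because
  Ramanujan sums are not completely multiplicative.
\<close>

lemma sum_divisors_mult_coprime:
  fixes f :: "nat \<Rightarrow> real"
  assumes cop: "coprime a b" and pos: "a > 0" "b > 0"
    and mult: "\<And>x y. x dvd a \<Longrightarrow> y dvd b \<Longrightarrow> f (x * y) = f x * f y"
  shows "(\<Sum>m | m dvd a * b. f m) = (\<Sum>m | m dvd a. f m) * (\<Sum>m | m dvd b. f m)"
proof -
  have "(\<Sum>m | m dvd a. f m) * (\<Sum>m | m dvd b. f m)
      = (\<Sum>z \<in> {m. m dvd a} \<times> {m. m dvd b}. f (fst z * snd z))"
    by (simp add: sum_product sum.cartesian_product case_prod_beta)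
       (rule sum.cong, auto simp: mult)
  also have "\<dots> = (\<Sum>m | m dvd a * b. f m)"
  proof (rule sum.reindex_bij_betw)
    show "bij_betw (\<lambda>z. fst z * snd z) ({m. m dvd a} \<times> {m. m dvd b}) {m. m dvd a * b}"
      unfolding bij_betw_def
    proof
      show "inj_on (\<lambda>z. fst z * snd z) ({m. m dvd a} \<times> {m. m dvd b})"
      proof (rule inj_onI, clarsimp)
        fix x y x' y' assume *: "x dvd a" "y dvd b" "x' dvd a" "y' dvd b" "x * y = x' * y'"
        then have "coprime x y'" "coprime x' y" "coprime x y" "coprime x' y'"
          using coprime_divisors[OF _ _ cop] by simp_all
        then show "x = x' \<and> y = y'"
          using * coprime_crossproduct_nat[of x y' x' y] by (simp add: coprime_commute)
      qed
      show "(\<lambda>z. fst z * snd z) ` ({m. m dvd a} \<times> {m. m dvd b}) = {m. m dvd a * b}"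
      proof (intro equalityI subsetI)
        fix m assume "m \<in> {m. m dvd a * b}"
        then obtain x y where "m = x * y" "x dvd a" "y dvd b"
          using division_decomp[of m a b] by blast
        then show "m \<in> (\<lambda>z. fst z * snd z) ` ({m. m dvd a} \<times> {m. m dvd b})"
          by force
      qed (auto intro: mult_dvd_mono)
    qed
  qed
  finally show ?thesis ..
qed

lemma sum_divisors_prime_power:
  fixes f :: "nat \<Rightarrow> real"
  assumes "prime q"
  shows "(\<Sum>m | m dvd q ^ a. f m) = (\<Sum>i\<le>a. f (q ^ i))"
proof -
  have "{m. m dvd q ^ a} = (\<lambda>i. q ^ i) ` {..a}"
    using divides_primepow_nat[OF assms] by auto
  moreover have "inj_on (\<lambda>i. q ^ i) {..a}"
    using prime_gt_1_nat[OF assms] by (auto intro: inj_onI)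
  ultimately show ?thesis by (simp add: sum.reindex)
qed

lemma sum_totient_divisors: "(\<Sum>m | m dvd M. real (totient m)) = real M"
  using totient_divisor_sum[of M] by (metis of_nat_sum)

text \<open>
  The nonnegative terms, up to exponent \<open>b\<close>, add up to \<open>q ^ b\<close> by Gauss's formula for the sum of
  totients.  The only other nonzero term is \<open>- q ^ b\<close>.
\<close>

lemma sum_ramanujan_prime_power:
  assumes q: "prime q" and b: "q ^ b dvd j" "\<not> q ^ Suc b dvd j" "b < a"
  shows "(\<Sum>m | m dvd q ^ a. ramanujan_sum j m) = 0"
    and "(\<Sum>m | m dvd q ^ a. \<bar>ramanujan_sum j m\<bar>) = 2 * real q ^ b"
proof -
  have qpos: "q > 0" using q prime_gt_0_nat by blast
  have low: "ramanujan_sum j m = real (totient m)" if "m dvd q ^ b" for m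
    using that b(1) qpos by (intro ramanujan_sum_dvd) (auto intro: dvd_trans intro!: dvd_pos_nat[of "q ^ b" m])
  have low': "(\<Sum>i\<le>b. ramanujan_sum j (q ^ i)) = real q ^ b"
    "(\<Sum>i\<le>b. \<bar>ramanujan_sum j (q ^ i)\<bar>) = real q ^ b"
    using sum_totient_divisors[of "q ^ b"] low
    by (simp_all add: sum_divisors_prime_power[OF q] le_imp_power_dvd)
  have split: "(\<Sum>m | m dvd q ^ a. f m) = (\<Sum>i\<le>b. f (q ^ i)) + f (q ^ Suc b)"
    if "\<And>i. i \<ge> b + 2 \<Longrightarrow> f (q ^ i) = 0" for f :: "nat \<Rightarrow> real"
  proof -
    have "(\<Sum>i\<le>a. f (q ^ i)) = (\<Sum>i\<le>Suc b. f (q ^ i))"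
      using b(3) that by (intro sum.mono_neutral_right) auto
    then show ?thesis by (simp add: sum_divisors_prime_power[OF q])
  qed
  note zero = ramanujan_sum_prime_power_eq_0[OF q b(1,2)]
  note one = ramanujan_sum_prime_power_Suc[OF q b(1,2)]
  show "(\<Sum>m | m dvd q ^ a. ramanujan_sum j m) = 0"
    using split[of "ramanujan_sum j"] zero low' one by (simp del: power_Suc)
  show "(\<Sum>m | m dvd q ^ a. \<bar>ramanujan_sum j m\<bar>) = 2 * real q ^ b"
    using split[of "\<lambda>m. \<bar>ramanujan_sum j m\<bar>"] zero low' one by (simp del: power_Suc)
qed

lemma sum_ramanujan_mult_coprime:
  assumes "coprime a b" "a > 0" "b > 0"
  shows "(\<Sum>m | m dvd a * b. ramanujan_sum j m)
      = (\<Sum>m | m dvd a. ramanujan_sum j m) * (\<Sum>m | m dvd b. ramanujan_sum j m)"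
    and "(\<Sum>m | m dvd a * b. \<bar>ramanujan_sum j m\<bar>)
      = (\<Sum>m | m dvd a. \<bar>ramanujan_sum j m\<bar>) * (\<Sum>m | m dvd b. \<bar>ramanujan_sum j m\<bar>)"
proof -
  have "ramanujan_sum j (x * y) = ramanujan_sum j x * ramanujan_sum j y"
    if "x dvd a" "y dvd b" for x y
    using that assms(1) coprime_divisors by (intro ramanujan_sum_mult_coprime) blast
  then show "(\<Sum>m | m dvd a * b. ramanujan_sum j m)
      = (\<Sum>m | m dvd a. ramanujan_sum j m) * (\<Sum>m | m dvd b. ramanujan_sum j m)"
    and "(\<Sum>m | m dvd a * b. \<bar>ramanujan_sum j m\<bar>)
      = (\<Sum>m | m dvd a. \<bar>ramanujan_sum j m\<bar>) * (\<Sum>m | m dvd b. \<bar>ramanujan_sum j m\<bar>)"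
    using assms by (auto intro!: sum_divisors_mult_coprime simp: abs_mult)
qed

lemma last_dividing_power:
  fixes q j :: nat
  assumes "\<not> q ^ a dvd j"
  obtains b where "b < a" "q ^ b dvd j" "\<not> q ^ Suc b dvd j"
proof -
  have "\<exists>b<a. (\<forall>i\<le>b. \<not> \<not> q ^ i dvd j) \<and> \<not> q ^ Suc b dvd j"
    using assms by (intro ex_least_nat_less) auto
  then show ?thesis using that by blast
qed

text \<open>
  If \<open>q ^ a\<close> does not divide \<open>j\<close>, the sum is \<open>2 * q ^ b\<close> with \<open>b < a\<close>; the factor \<open>2\<close> is
  absorbed because \<open>2 \<le> q\<close>.
\<close>

lemma sum_abs_ramanujan_prime_power_le:
  assumes q: "prime q"
  shows "(\<Sum>m | m dvd q ^ a. \<bar>ramanujan_sum j m\<bar>) \<le> real q ^ a"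
proof (cases "q ^ a dvd j")
  case True
  have "\<bar>ramanujan_sum j m\<bar> = real (totient m)" if "m dvd q ^ a" for m
  proof -
    have "m > 0" using dvd_pos_nat[OF _ that] prime_gt_0_nat[OF q] by simp
    then show ?thesis using ramanujan_sum_dvd[of m j] dvd_trans[OF that True] by simp
  qed
  then show ?thesis using sum_totient_divisors[of "q ^ a"] by simp
next
  case False
  then obtain b where b: "b < a" "q ^ b dvd j" "\<not> q ^ Suc b dvd j"
    by (rule last_dividing_power)
  have q2: "real q \<ge> 2" using prime_ge_2_nat[OF q] by simp
  have "2 * real q ^ b \<le> real q ^ Suc b" using q2 by simp
  also have "\<dots> \<le> real q ^ a" using q2 b by (intro power_increasing) auto
  finally show ?thesis using sum_ramanujan_prime_power[OF q b(2,3,1)] by simp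
qed

text \<open>
  The bound for prime powers, multiplied up by splitting off one prime at a time.
\<close>

lemma sum_abs_ramanujan_le:
  "M > 0 \<Longrightarrow> (\<Sum>m | m dvd M. \<bar>ramanujan_sum j m\<bar>) \<le> real M"
proof (induction M rule: less_induct)
  case (less M)
  show ?case
  proof (cases "M = 1")
    case True
    then show ?thesis by (simp add: ramanujan_sum_dvd)
  next
    case False
    then obtain q where q: "prime q" "q dvd M" using prime_factor_nat by blast
    obtain a N where N: "\<not> q dvd N" "M = N * q ^ a"
      using prime_power_canonical[OF q(1) less.prems] by blast
    have Npos: "N > 0" using N less.prems by (intro gr0I) auto
    have "a > 0" using q N by (intro gr0I) auto
    then have "q ^ a > 1" using prime_gt_1_nat[OF q(1)] one_less_power by blast
    then have "N < M" using N Npos by simp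
    have cop: "coprime (q ^ a) N" using q N by (simp add: prime_imp_coprime_nat)
    have "(\<Sum>m | m dvd M. \<bar>ramanujan_sum j m\<bar>)
        = (\<Sum>m | m dvd q ^ a. \<bar>ramanujan_sum j m\<bar>) * (\<Sum>m | m dvd N. \<bar>ramanujan_sum j m\<bar>)"
      using sum_ramanujan_mult_coprime(2)[OF cop, of j] Npos prime_gt_0_nat[OF q(1)] unfolding N(2)
      by (simp add: mult.commute)
    also have "\<dots> \<le> real q ^ a * real N"
      by (intro mult_mono sum_abs_ramanujan_prime_power_le q less.IH \<open>N < M\<close> Npos sum_nonneg) auto
    finally show ?thesis using N by (simp add: mult.commute)
  qed
qed

lemma not_dvd_prime_power_factor:
  fixes n j :: nat
  assumes "n > 0" "\<not> n dvd j"
  obtains q a N where "prime q" "coprime (q ^ a) N" "n = q ^ a * N" "\<not> q ^ a dvd j"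
proof -
  have "j \<noteq> 0" using assms by (intro notI) simp
  then obtain q where q: "prime q" "\<not> multiplicity q n \<le> multiplicity q j"
    using multiplicity_le_imp_dvd[of n j] assms by blast
  define a where "a = multiplicity q n"
  obtain N where N: "n = q ^ a * N" "\<not> q dvd N"
    using multiplicity_decompose'[of n q] assms q not_prime_unit[of q] unfolding a_def by blast
  show ?thesis
  proof (rule that[OF q(1) _ N(1)])
    show "coprime (q ^ a) N" using q N by (simp add: prime_imp_coprime_nat)
    show "\<not> q ^ a dvd j"
      using q \<open>j \<noteq> 0\<close> not_prime_unit[of q] unfolding a_def
      by (subst power_dvd_iff_le_multiplicity) auto
  qed
qed

text \<open>
  Some prime power \<open>q ^ a\<close> exactly dividing \<open>n\<close> does not divide \<open>j\<close>.  Its factor makes the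
  divisor sum vanish, and in the sum of absolute values it contributes at most \<open>2 * q ^ (a - 1)\<close>,
  which saves \<open>q / 2\<close> against the trivial bound \<open>n\<close>.
\<close>

lemma sum_ramanujan_not_dvd:
  assumes "n > 0" "\<not> n dvd j"
  obtains q where "prime q" "q dvd n"
    "(\<Sum>m | m dvd n. ramanujan_sum j m) = 0"
    "(\<Sum>m | m dvd n. \<bar>ramanujan_sum j m\<bar>) \<le> 2 * real n / real q"
proof -
  obtain q a N where q: "prime q" "coprime (q ^ a) N" "n = q ^ a * N" "\<not> q ^ a dvd j"
    using not_dvd_prime_power_factor[OF assms] by blast
  obtain b where b: "b < a" "q ^ b dvd j" "\<not> q ^ Suc b dvd j"
    using last_dividing_power[OF q(4)] by blast
  have qpos: "q > 0" using q(1) prime_gt_0_nat by blast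
  have Npos: "N > 0" using q assms by (intro gr0I) auto
  note mult = sum_ramanujan_mult_coprime[OF q(2), of j]
  note pp = sum_ramanujan_prime_power[OF q(1) b(2,3,1)]
  have "(\<Sum>m | m dvd n. \<bar>ramanujan_sum j m\<bar>) \<le> 2 * real q ^ b * real N"
    using mult(2) pp(2) sum_abs_ramanujan_le[OF Npos, of j] qpos Npos q(3) by (simp add: mult_left_mono)
  also have "\<dots> = 2 * real q ^ Suc b * real N / real q" using qpos by simp
  also have "\<dots> \<le> 2 * real n / real q"
  proof -
    have "real q ^ Suc b \<le> real q ^ a" using qpos b by (intro power_increasing) auto
    then show ?thesis unfolding q(3) by (simp add: divide_right_mono mult_right_mono del: power_Suc)
  qed
  finally show ?thesis
    using that[OF q(1)] mult(1) pp(1) qpos Npos b(1) q(3) by simp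
qed

lemma sum_divisors_complementary:
  fixes f :: "nat \<Rightarrow> real"
  assumes "n > 0"
  shows "(\<Sum>d | d dvd n. f (n div d)) = (\<Sum>d | d dvd n. f d)"
proof (rule sum.reindex_bij_witness[of _ "\<lambda>d. n div d" "\<lambda>d. n div d"])
  fix d assume "d \<in> {d. d dvd n}"
  then obtain e where e: "n = d * e" by blast
  then have "d > 0" "e > 0" using assms by auto
  then show "n div (n div d) = d" "n div (n div d) = d" "n div d \<in> {d. d dvd n}" "n div d \<in> {d. d dvd n}"
    using e by auto
qed auto

section \<open>A lower bound valid for every divisor set\<close>

text \<open>
  Whatever \<open>D\<close> is, the eigenvalue is at least the sum of all negative Ramanujan sums over divisors
  of \<open>n\<close>, that is, half the difference between the sum and the sum of absolute values.
\<close>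

lemma ICG_eigenvalue_ge_sums:
  assumes "n > 0" "D \<subseteq> proper_divisors n"
  shows "2 * ICG_eigenvalue n D j
    \<ge> (\<Sum>m | m dvd n. ramanujan_sum j m) - (\<Sum>m | m dvd n. \<bar>ramanujan_sum j m\<bar>)"
proof -
  let ?g = "\<lambda>m. ramanujan_sum j m - \<bar>ramanujan_sum j m\<bar>"
  have sub: "D \<subseteq> {d. d dvd n}" using assms by (auto simp: proper_divisors_def)
  have "(\<Sum>m | m dvd n. ramanujan_sum j m) - (\<Sum>m | m dvd n. \<bar>ramanujan_sum j m\<bar>)
      = (\<Sum>d | d dvd n. ?g (n div d))"
    unfolding sum_divisors_complementary[OF assms(1), of ?g] by (simp add: sum_subtractf)
  also have "\<dots> \<le> (\<Sum>d\<in>D. ?g (n div d))"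
  proof -
    have "(\<Sum>d\<in>D. - ?g (n div d)) \<le> (\<Sum>d | d dvd n. - ?g (n div d))"
      using sub assms by (intro sum_mono2) auto
    then show ?thesis by (simp add: sum_negf sum_subtractf)
  qed
  also have "\<dots> \<le> (\<Sum>d\<in>D. 2 * ramanujan_sum j (n div d))"
    by (intro sum_mono) auto
  finally show ?thesis by (simp add: ICG_eigenvalue_def sum_distrib_left)
qed

section \<open>Critical indices\<close>

text \<open>
  With \<open>n = p ^ a * M\<close> and \<open>p\<close> not dividing \<open>M\<close>, call \<open>j\<close> critical if it is a multiple of
  \<open>n div p\<close> but not of \<open>n\<close>.  At such an index the sign of a Ramanujan sum depends only on whether
  \<open>p\<close> divides \<open>d\<close>.  If it does, \<open>n div d\<close> divides \<open>n div p\<close> and hence \<open>j\<close>, so the value is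
  positive; otherwise \<open>d\<close> divides \<open>M\<close>, and the next lemma gives a negative value.
\<close>

lemma ramanujan_sum_critical_dvd:
  assumes p: "prime p" and n: "n = p ^ a * M" and a: "a \<ge> 1" and M: "M > 0"
    and j: "p ^ (a - 1) * M dvd j" and d: "d dvd n" "p dvd d"
  shows "ramanujan_sum j (n div d) = real (totient (n div d))"
proof (rule ramanujan_sum_dvd)
  have ppos: "p > 0" using p prime_gt_0_nat by blast
  have npos: "n > 0" using n M ppos by simp
  obtain c where c: "n = d * c" using d(1) by blast
  then have dc: "n div d = c" "c > 0" using npos by auto
  then show "n div d > 0" by simp
  have "n div d * p dvd n" unfolding dc(1) using d(2) c by (simp add: mult.commute mult_dvd_mono)
  moreover have "n = p ^ (a - 1) * M * p" using n a by (cases a) auto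
  ultimately have "n div d dvd p ^ (a - 1) * M" using ppos by simp
  then show "n div d dvd j" using j dvd_trans by blast
qed

lemma ramanujan_sum_critical_coprime:
  assumes p: "prime p" and n: "n = p ^ a * M" and a: "a \<ge> 1" and M: "M > 0" "\<not> p dvd M"
    and j: "p ^ (a - 1) * M dvd j" "\<not> p ^ a dvd j" and d: "d dvd M"
  shows "ramanujan_sum j (n div d) = - (real p ^ (a - 1)) * real (totient (M div d))"
proof -
  obtain c where c: "M = d * c" using d by blast
  then have "d > 0" "c > 0" using M by auto
  then have e: "M div d dvd M" "M div d > 0" using c by simp_all
  have "n div d = p ^ a * (M div d)" using n d by (simp add: div_mult_swap)
  moreover have "coprime (p ^ a) (M div d)"
  proof -
    have "\<not> p dvd M div d" using M(2) e(1) dvd_trans[of p "M div d" M] by blast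
    then show ?thesis using p by (simp add: prime_imp_coprime_nat)
  qed
  moreover have "ramanujan_sum j (p ^ a) = - (real p ^ (a - 1))"
    using ramanujan_sum_prime_power_Suc[OF p, of "a - 1" j] j a by (auto elim: dvd_mult_left)
  moreover have "ramanujan_sum j (M div d) = real (totient (M div d))"
    using dvd_trans[OF e(1) dvd_mult_right[OF j(1)]] e(2) by (rule ramanujan_sum_dvd)
  ultimately show ?thesis by (simp add: ramanujan_sum_mult_coprime)
qed

lemma sum_ramanujan_critical:
  assumes "prime p" "n = p ^ a * M" "a \<ge> 1" "M > 0" "\<not> p dvd M"
    "p ^ (a - 1) * M dvd j" "\<not> p ^ a dvd j"
  shows "(\<Sum>d | d dvd M. ramanujan_sum j (n div d)) = - (real p ^ (a - 1) * real M)"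
proof -
  have "(\<Sum>d | d dvd M. ramanujan_sum j (n div d))
      = - (real p ^ (a - 1)) * (\<Sum>d | d dvd M. real (totient (M div d)))"
    unfolding sum_distrib_left
    by (rule sum.cong[OF refl]) (use ramanujan_sum_critical_coprime[OF assms] in simp)
  then show ?thesis
    using sum_divisors_complementary[OF assms(4), of "\<lambda>m. real (totient m)"] sum_totient_divisors[of M]
    by simp
qed

lemma dvd_prime_power_mult_cancel:
  fixes p d M :: nat
  assumes "prime p" "\<not> p dvd d" "d dvd p ^ a * M"
  shows "d dvd M"
proof -
  have "coprime d (p ^ a)"
    using prime_imp_coprime_nat[OF assms(1,2)] by (simp add: coprime_commute)
  then show ?thesis using assms(3) coprime_dvd_mult_right_iff by blast
qed

text \<open>
  All negative contributions together give \<open>- p ^ (a - 1) * M\<close>.  The divisor \<open>e\<close> of \<open>M\<close> missing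
  from \<open>D\<close> returns \<open>p ^ (a - 1) * totient (M div e)\<close>, which is at least \<open>p ^ (a - 1)\<close>.
\<close>

lemma ICG_eigenvalue_critical_ge:
  assumes ass: "prime p" "n = p ^ a * M" "a \<ge> 1" "M > 0" "\<not> p dvd M"
    "p ^ (a - 1) * M dvd j" "\<not> p ^ a dvd j"
    and D: "D \<subseteq> proper_divisors n" and e: "e dvd M" "e \<notin> D"
  shows "ICG_eigenvalue n D j \<ge> - (real p ^ (a - 1) * real M) + real p ^ (a - 1)"
proof -
  let ?c = "\<lambda>d. ramanujan_sum j (n div d)"
  have fin: "finite {d. d dvd M}" "finite D"
    using ass prime_gt_0_nat[OF ass(1)] finite_subset[OF D, unfolded proper_divisors_def] by auto
  have sub: "{d \<in> D. \<not> p dvd d} \<subseteq> {d. d dvd M} - {e}"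
  proof
    fix d assume d: "d \<in> {d \<in> D. \<not> p dvd d}"
    then have "d dvd p ^ a * M" using D ass(2) by (auto simp: proper_divisors_def)
    moreover have "\<not> p dvd d" using d by simp
    ultimately have "d dvd M" using dvd_prime_power_mult_cancel[OF ass(1)] by blast
    then show "d \<in> {d. d dvd M} - {e}" using d e by auto
  qed
  have val: "?c d = - (real p ^ (a - 1)) * real (totient (M div d))" if "d dvd M" for d
    using ramanujan_sum_critical_coprime[OF ass that] .
  have "M div e > 0" using e(1) ass(4) by (auto elim!: dvdE)
  then have "1 \<le> real (totient (M div e))" by (simp add: Suc_le_eq)
  then have "real p ^ (a - 1) * 1 \<le> real p ^ (a - 1) * real (totient (M div e))"
    by (intro mult_left_mono) auto
  then have "- (real p ^ (a - 1) * real M) + real p ^ (a - 1) \<le> - (real p ^ (a - 1) * real M) - ?c e"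
    using val[OF e(1)] by simp
  also have "\<dots> = (\<Sum>d\<in>{d. d dvd M} - {e}. ?c d)"
    using sum_ramanujan_critical[OF ass] fin e by (simp add: sum_diff1)
  also have "\<dots> \<le> (\<Sum>d\<in>{d \<in> D. \<not> p dvd d}. ?c d)"
  proof -
    have "(\<Sum>d\<in>{d \<in> D. \<not> p dvd d}. - ?c d) \<le> (\<Sum>d\<in>{d. d dvd M} - {e}. - ?c d)"
      using sub fin val by (intro sum_mono2) auto
    then show ?thesis by (simp add: sum_negf)
  qed
  also have "\<dots> \<le> (\<Sum>d\<in>D. ?c d)"
  proof (rule sum_mono2)
    fix d assume "d \<in> D - {d \<in> D. \<not> p dvd d}"
    then have "d dvd n" "p dvd d" using D by (auto simp: proper_divisors_def)
    then show "0 \<le> ?c d" using ramanujan_sum_critical_dvd[OF ass(1-4,6)] by simp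
  qed (use fin in auto)
  finally show ?thesis by (simp add: ICG_eigenvalue_def)
qed

section \<open>Consequences of connectedness\<close>

text \<open>
  If \<open>p\<close> divided all of \<open>D\<close>, every edge would join vertices that are congruent modulo \<open>p\<close>, and no
  walk would lead from \<open>0\<close> to \<open>1\<close>.
\<close>

lemma connected_ICG_not_all_dvd:
  assumes n: "n \<ge> 2" and p: "prime p" "p dvd n"
    and con: "Digraph_Component.connected (with_proj (ICG n D))"
  shows "\<exists>d\<in>D. \<not> p dvd d"
proof (rule ccontr)
  assume "\<not> ?thesis"
  then have all: "p dvd d" if "d \<in> D" for d using that by blast
  let ?H = "with_proj (mk_symmetric (with_proj (ICG n D)))"
  have arc: "int p dvd u - v" if "(u, v) \<in> arcs_ends ?H" for u v
  proof -
    have "(u, v) \<in> parcs (ICG n D) \<or> (v, u) \<in> parcs (ICG n D)"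
      using that by (auto simp: parcs_mk_symmetric arcs_ends_def arc_to_ends_def)
    then have "(u, v) \<in> parcs (ICG n D)" using ICG_symmetric by blast
    then have "p dvd nat (gcd (u - v) (int n))" using all by (auto simp: ICG_def)
    then have "int p dvd int (nat (gcd (u - v) (int n)))" using int_dvd_int_iff by blast
    then show ?thesis by simp
  qed
  have "strongly_connected ?H" using con by (simp add: connected_def)
  then have "0 \<rightarrow>\<^sup>*\<^bsub>?H\<^esub> 1" using n by (auto simp: strongly_connected_def ICG_def)
  then have "(0, 1) \<in> (arcs_ends ?H)\<^sup>*" by (rule reachable_rtranclI)
  then have "int p dvd 0 - 1"
  proof (induction rule: rtrancl_induct)
    case (step y z)
    then have "int p dvd (0 - y) + (y - z)" using arc by (intro dvd_add) auto
    then show ?case by simp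
  qed simp
  then show False using p(1) by simp
qed

section \<open>The lower bound for the eigenvalues\<close>

text \<open>
  Cases according to which of \<open>p ^ a\<close> and \<open>M\<close> divide \<open>j\<close>.  If both do, no term is negative.
  At any other index that is not critical, half the sum of absolute values is already at most
  \<open>p ^ (a - 1) * (M - 1)\<close>, whatever \<open>D\<close> is.  The missing divisor \<open>e\<close> decides the critical ones.
\<close>

lemma ICG_eigenvalue_ge:
  assumes p: "prime p" and n: "n = p ^ a * M" and a: "a \<ge> 1" and M: "M > 1" "\<not> p dvd M"
    and larger: "\<And>q. prime q \<Longrightarrow> q dvd M \<Longrightarrow> p < q"
    and D: "D \<subseteq> proper_divisors n" and e: "e dvd M" "e \<notin> D"
  shows "ICG_eigenvalue n D j \<ge> - (real p ^ (a - 1) * real M) + real p ^ (a - 1)"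
proof -
  define P where "P = real p ^ (a - 1)"
  have ppos: "p > 0" using p prime_gt_0_nat by blast
  have p2: "real p \<ge> 2" using prime_ge_2_nat[OF p] by simp
  have Ppos: "P > 0" unfolding P_def using ppos by simp
  have pa: "real p ^ a = real p * P" unfolding P_def using a by (cases a) auto
  have cop: "coprime (p ^ a) M" using p M by (simp add: prime_imp_coprime_nat)
  have npos: "n > 0" using n M ppos by simp
  define Z S where "Z = (\<lambda>n. \<Sum>m | m dvd n. ramanujan_sum j m)"
    and "S = (\<lambda>n. \<Sum>m | m dvd n. \<bar>ramanujan_sum j m\<bar>)"
  have bound: "2 * ICG_eigenvalue n D j \<ge> Z n - S n"
    unfolding Z_def S_def using ICG_eigenvalue_ge_sums[OF npos D] .
  have mult: "Z n = Z (p ^ a) * Z M" "S n = S (p ^ a) * S M"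
    unfolding Z_def S_def n using sum_ramanujan_mult_coprime[OF cop] ppos M by auto
  have S_nonneg: "S m \<ge> 0" for m unfolding S_def by (simp add: sum_nonneg)
  have S_le: "S m \<le> real m" if "m > 0" for m
    unfolding S_def using sum_abs_ramanujan_le[OF that] .
  \<comment> \<open>The prime \<open>q\<close> exceeds \<open>p\<close>, so \<open>p * M / q\<close> falls short of \<open>M\<close> by at least the positive
    integer \<open>M / q\<close>.\<close>
  have M_part: "Z M = 0 \<and> real p * S M \<le> 2 * (real M - 1)" if nd: "\<not> M dvd j"
  proof -
    obtain q where q: "prime q" "q dvd M" "Z M = 0" "S M \<le> 2 * real M / real q"
      unfolding Z_def S_def using sum_ramanujan_not_dvd[of M j] nd M by auto
    obtain r where r: "M = q * r" using q by blast
    have rpos: "r \<ge> 1" using r M by (cases r) auto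
    have "p + 1 \<le> q" using larger q by (simp add: Suc_le_eq)
    then have "(p + 1) * r \<le> q * r" by (rule mult_right_mono) simp
    then have "p * r + 1 \<le> M" using rpos unfolding r by simp
    then have "real (p * r + 1) \<le> real M" by (simp only: of_nat_le_iff)
    then have "real p * real r + 1 \<le> real M" by simp
    moreover have "S M \<le> 2 * real r" using q(1,4) r prime_gt_0_nat[OF q(1)] by simp
    then have "real p * S M \<le> real p * (2 * real r)" by (intro mult_left_mono) auto
    ultimately show ?thesis using q(3) by simp
  qed
  have "- (P * real M) + P \<le> ICG_eigenvalue n D j"
  proof (cases "p ^ a dvd j")
    case pj: True
    show ?thesis
    proof (cases "M dvd j")
      case True
      then have nj: "n dvd j" using pj cop n by (simp add: divides_mult)
      have "ramanujan_sum j (n div d) \<ge> 0" if "d \<in> D" for d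
      proof -
        have "d dvd n" using that D by (auto simp: proper_divisors_def)
        then obtain c where "n = d * c" by blast
        then have "n div d = c" "c > 0" "c dvd n" using npos by auto
        then show ?thesis using ramanujan_sum_dvd[of c j] dvd_trans[of c n j] nj by simp
      qed
      then have "0 \<le> ICG_eigenvalue n D j" unfolding ICG_eigenvalue_def by (simp add: sum_nonneg)
      moreover have "P * 1 \<le> P * real M" using Ppos M by (intro mult_left_mono) auto
      ultimately show ?thesis by simp
    next
      case False
      have "S n \<le> (real p * P) * S M"
        unfolding mult using S_le[of "p ^ a"] ppos S_nonneg pa by (intro mult_right_mono) auto
      also have "\<dots> = P * (real p * S M)" by simp
      also have "\<dots> \<le> P * (2 * (real M - 1))"
        using M_part[OF False] Ppos by (intro mult_left_mono) auto
      finally have "S n \<le> 2 * (P * real M) - 2 * P" by (simp add: algebra_simps)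
      moreover have "Z n = 0" unfolding mult using M_part[OF False] by simp
      ultimately show ?thesis using bound by linarith
    qed
  next
    case pj: False
    obtain b where b: "b < a" "p ^ b dvd j" "\<not> p ^ Suc b dvd j"
      using last_dividing_power[OF pj] by blast
    have pp: "Z (p ^ a) = 0" "S (p ^ a) = 2 * real p ^ b"
      unfolding Z_def S_def using sum_ramanujan_prime_power[OF p b(2,3,1)] .
    have Zn: "Z n = 0" unfolding mult pp by simp
    show ?thesis
    proof (cases "M dvd j")
      case False
      have "real p ^ b \<le> P" unfolding P_def using p2 b by (intro power_increasing) auto
      then have "S n \<le> (2 * P) * S M"
        unfolding mult pp using S_nonneg by (intro mult_right_mono) auto
      also have "\<dots> = P * (2 * S M)" by simp
      also have "\<dots> \<le> P * (2 * (real M - 1))"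
      proof (rule mult_left_mono)
        have "2 * S M \<le> real p * S M" using p2 S_nonneg by (intro mult_right_mono) auto
        then show "2 * S M \<le> 2 * (real M - 1)" using M_part[OF False] by simp
      qed (use Ppos in simp)
      finally have "S n \<le> 2 * (P * real M) - 2 * P" by (simp add: algebra_simps)
      then show ?thesis using bound Zn by linarith
    next
      case Mj: True
      show ?thesis
      proof (cases "b = a - 1")
        case True
        have "coprime (p ^ (a - 1)) M" using p M by (simp add: prime_imp_coprime_nat)
        then have "p ^ (a - 1) * M dvd j" using Mj b(2) True by (simp add: divides_mult)
        then show ?thesis
          using ICG_eigenvalue_critical_ge[OF p n a _ M(2) _ pj D e] M(1) unfolding P_def by simp
      next
        case False
        have "2 * real p ^ b \<le> real p * real p ^ b" using p2 by (intro mult_right_mono) auto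
        also have "\<dots> = real p ^ Suc b" by simp
        also have "\<dots> \<le> P" unfolding P_def using p2 b False by (intro power_increasing) auto
        finally have "S n \<le> P * real M"
          unfolding mult pp using S_nonneg S_le[of M] M Ppos by (intro mult_mono) auto
        moreover have "P * real M \<le> P * (2 * (real M - 1))"
          using Ppos M by (intro mult_left_mono) auto
        ultimately have "S n \<le> 2 * (P * real M) - 2 * P" by (simp add: algebra_simps)
        then show ?thesis using bound Zn by linarith
      qed
    qed
  qed
  then show ?thesis unfolding P_def .
qed

section \<open>Cases of equality\<close>

text \<open>
  \<open>D\<close> collects all negative contributions at a critical index except the one of \<open>d = M\<close>,
  whose absolute value \<open>p ^ (a - 1) * totient 1\<close> is the least possible.
\<close>

lemma ICG_eigenvalue_all_coprime_but_one:
  assumes ass: "prime p" "n = p ^ a * M" "a \<ge> 1" "M > 0" "\<not> p dvd M"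
    "p ^ (a - 1) * M dvd j" "\<not> p ^ a dvd j"
    and D: "D = {d \<in> proper_divisors n. \<not> p dvd d} - {M}"
  shows "ICG_eigenvalue n D j = - (real p ^ (a - 1) * real M) + real p ^ (a - 1)"
proof -
  have ppos: "p > 0" using ass(1) prime_gt_0_nat by blast
  have npos: "n > 0" using ass ppos by simp
  have "{d \<in> proper_divisors n. \<not> p dvd d} = {d. d dvd M}"
  proof (intro equalityI subsetI)
    fix d assume d: "d \<in> {d \<in> proper_divisors n. \<not> p dvd d}"
    then have "\<not> p dvd d" "d dvd p ^ a * M" using ass(2) by (auto simp: proper_divisors_def)
    then show "d \<in> {d. d dvd M}" using dvd_prime_power_mult_cancel[OF ass(1)] by blast
  next
    fix d assume d: "d \<in> {d. d dvd M}"
    then have "d dvd n" "\<not> p dvd d" using ass(2,5) dvd_trans[of p d M] by auto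
    moreover have "p dvd n" using ass(2,3) by simp
    moreover have "d > 0" using d ass(4) by (auto elim!: dvdE)
    moreover have "d \<noteq> n" using \<open>\<not> p dvd d\<close> \<open>p dvd n\<close> by blast
    moreover have "d \<le> n" using \<open>d dvd n\<close> npos by (rule dvd_imp_le)
    ultimately show "d \<in> {d \<in> proper_divisors n. \<not> p dvd d}"
      by (simp add: proper_divisors_def Suc_le_eq)
  qed
  then have "ICG_eigenvalue n D j = (\<Sum>d\<in>{d. d dvd M} - {M}. ramanujan_sum j (n div d))"
    using D by (simp add: ICG_eigenvalue_def)
  also have "\<dots> = - (real p ^ (a - 1) * real M) - ramanujan_sum j (n div M)"
    using sum_ramanujan_critical[OF ass] ass(4) by (simp add: sum_diff1)
  also have "ramanujan_sum j (n div M) = - (real p ^ (a - 1))"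
    using ramanujan_sum_critical_coprime[OF ass, of M] ass(4) by simp
  finally show ?thesis by simp
qed

text \<open>
  The divisors \<open>2 ^ i\<close> contribute \<open>- totient (2 ^ (a - i))\<close>, altogether \<open>- 2 ^ (a - 1)\<close>, and the
  divisor \<open>3\<close> contributes another \<open>- 2 ^ (a - 1)\<close>.
\<close>

lemma ICG_eigenvalue_two_power_times_three:
  assumes a: "a \<ge> 1" and n: "n = 2 ^ a * 3"
    and D: "D = (\<lambda>i. 2 ^ i) ` {1..a} \<union> {3}"
    and j: "2 ^ (a - 1) dvd j" "\<not> 2 ^ a dvd j" "\<not> 3 dvd j"
  shows "ICG_eigenvalue n D j = - (2 ^ a)"
proof -
  have c3: "ramanujan_sum j 3 = -1"
    using ramanujan_sum_prime_power_Suc[of 3 0 j] j by simp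
  have c2a: "ramanujan_sum j (2 ^ a) = - (2 ^ (a - 1))"
    using ramanujan_sum_prime_power_Suc[of 2 "a - 1" j] j a by simp
  have val: "ramanujan_sum j (n div 2 ^ i) = - real (totient (2 ^ (a - i)))" if i: "i \<in> {1..a}" for i
  proof -
    have "n div 2 ^ i = 2 ^ (a - i) * 3"
      using i unfolding n by (simp add: power_diff div_mult_swap le_imp_power_dvd mult.commute)
    moreover have "coprime (2 ^ (a - i)) (3::nat)" by simp
    moreover have "(2::nat) ^ (a - i) dvd j"
      using i j(1) by (meson atLeastAtMost_iff diff_le_mono2 dvd_trans le_imp_power_dvd)
    ultimately show ?thesis
      using c3 by (simp add: ramanujan_sum_mult_coprime ramanujan_sum_dvd)
  qed
  have notin: "(3::nat) \<notin> (\<lambda>i. 2 ^ i) ` {1..a}"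
  proof
    assume "(3::nat) \<in> (\<lambda>i. 2 ^ i) ` {1..a}"
    moreover have "even x" if "x \<in> (\<lambda>i. 2 ^ i) ` {1..a}" for x :: nat using that by auto
    ultimately have "even (3::nat)" by blast
    then show False by simp
  qed
  have "ICG_eigenvalue n D j = (\<Sum>i=1..a. ramanujan_sum j (n div 2 ^ i)) + ramanujan_sum j (n div 3)"
    unfolding ICG_eigenvalue_def D using notin by (simp add: sum.reindex inj_on_def)
  also have "ramanujan_sum j (n div 3) = - (2 ^ (a - 1))" using n c2a by simp
  also have "(\<Sum>i=1..a. ramanujan_sum j (n div 2 ^ i)) = - (\<Sum>i=1..a. real (totient (2 ^ (a - i))))"
    unfolding sum_negf[symmetric] by (rule sum.cong[OF refl]) (rule val)
  also have "(\<Sum>i=1..a. real (totient (2 ^ (a - i)))) = (\<Sum>i\<le>a - 1. real (totient (2 ^ i)))"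
    by (rule sum.reindex_bij_witness[of _ "\<lambda>i. a - i" "\<lambda>i. a - i"]) (use a in auto)
  also have "\<dots> = 2 ^ (a - 1)"
    using sum_divisors_prime_power[of 2 "\<lambda>m. real (totient m)" "a - 1"] sum_totient_divisors[of "2 ^ (a - 1)"]
    by simp
  finally show ?thesis using a by (cases a) auto
qed

section \<open>Least eigenvalues of connected integral circulant graphs\<close>

lemma smallest_prime_factorization:
  fixes p \<alpha> :: "nat \<Rightarrow> nat"
  assumes n: "n \<ge> 2" "n = (\<Prod>i=1..k. p i ^ \<alpha> i)" and mono: "strict_mono_on {1..k} p"
    and prime: "\<And>i. i \<in> {1..k} \<Longrightarrow> prime (p i)"
  obtains M where "1 \<in> {1..k}" "n = p 1 ^ \<alpha> 1 * M" "M > 0"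
    "\<And>q. prime q \<Longrightarrow> q dvd M \<Longrightarrow> p 1 < q"
proof -
  have k: "1 \<in> {1..k}" using n by (cases "k = 0") auto
  define M where "M = (\<Prod>i=2..k. p i ^ \<alpha> i)"
  have "{1..k} = insert 1 {2..k}" using k by auto
  then have "n = p 1 ^ \<alpha> 1 * M" using n(2) by (simp add: M_def)
  moreover have "p 1 < q" if q: "prime q" "q dvd M" for q
  proof -
    obtain i where i: "i \<in> {2..k}" "q dvd p i ^ \<alpha> i"
      using q prime_dvd_prod_iff[of "{2..k}" q "\<lambda>i. p i ^ \<alpha> i"] unfolding M_def by auto
    then have "q dvd p i" using q(1) prime_dvd_power by blast
    then have "q = p i" using primes_dvd_imp_eq[OF q(1) prime[of i]] i by auto
    moreover have "p 1 < p i" using strict_mono_onD[OF mono k, of i] i by auto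
    ultimately show ?thesis by simp
  qed
  moreover have "M > 0" using calculation(1) n(1) by (intro gr0I) auto
  ultimately show ?thesis using that k by blast
qed

theorem theorem4:
  fixes n k :: nat and p \<alpha> :: "nat \<Rightarrow> nat" and D :: "nat set"
  assumes "n \<ge> 2"
    and "n = (\<Prod>i=1..k. p i ^ \<alpha> i)"
    and "strict_mono_on {1..k} p"
    and "\<And>i. i \<in> {1..k} \<Longrightarrow> prime (p i)"
    and "\<And>i. i \<in> {1..k} \<Longrightarrow> \<alpha> i \<ge> 1"
    and "D \<subseteq> proper_divisors n"
    and "Digraph_Component.connected (with_proj (ICG n D))"
    and "Digraph_Component.connected (with_proj (graph_complement (ICG n D)))"
  shows "(\<forall>j\<in>{1..n}. ICG_eigenvalue n D j \<ge> - (real n / real (p 1)) + real (p 1) ^ (\<alpha> 1 - 1))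
    \<and> (D = {d \<in> proper_divisors n. \<not> p 1 dvd d} - {n div p 1 ^ \<alpha> 1} \<longrightarrow>
        (\<forall>j\<in>{1..n - 1}. n div p 1 dvd j \<longrightarrow>
          ICG_eigenvalue n D j = - (real n / real (p 1)) + real (p 1) ^ (\<alpha> 1 - 1)))
    \<and> (n = 2 ^ \<alpha> 1 * 3 \<and> D = (\<lambda>i. 2 ^ i) ` {1..\<alpha> 1} \<union> {3} \<longrightarrow>
        (\<forall>j\<in>{1..n - 1}. exactly_divides 2 (\<alpha> 1 - 1) j \<and> \<not> 3 dvd j \<longrightarrow>
          ICG_eigenvalue n D j = - (real n / real (p 1)) + real (p 1) ^ (\<alpha> 1 - 1)))"
proof -
  obtain M where k: "1 \<in> {1..k}" and n: "n = p 1 ^ \<alpha> 1 * M" and Mpos: "M > 0"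
    and larger: "\<And>q. prime q \<Longrightarrow> q dvd M \<Longrightarrow> p 1 < q"
    using smallest_prime_factorization[OF assms(1-4)] by blast
  define P a where "P = p 1" and "a = \<alpha> 1"
  note n = n[folded P_def a_def] and larger = larger[folded P_def]
  have P: "prime P" and a: "a \<ge> 1" unfolding P_def a_def using assms(4,5) k by auto
  have Ppos: "P > 0" using P prime_gt_0_nat by blast
  have PM: "\<not> P dvd M" using larger P by blast
  have Pn: "P dvd n" using n a by simp
  have nP: "n div P = P ^ (a - 1) * M" using n a Ppos by (cases a) auto
  have bound: "- (real n / real P) + real P ^ (a - 1) = - (real P ^ (a - 1) * real M) + real P ^ (a - 1)"
    using n a Ppos by (cases a) auto
  obtain d where d: "d \<in> D" "\<not> P dvd d"
    using connected_ICG_not_all_dvd[OF assms(1) P Pn assms(7)] by blast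
  obtain e where e: "e \<in> proper_divisors n - D" "\<not> P dvd e"
    using connected_ICG_not_all_dvd[OF assms(1) P Pn] assms(8) graph_complement_ICG[OF assms(6)] by metis
  have "d dvd P ^ a * M" "e dvd P ^ a * M"
    using d(1) e(1) assms(6) unfolding n[symmetric] by (auto simp: proper_divisors_def)
  then have dM: "d dvd M" and eM: "e dvd M"
    using d(2) e(2) dvd_prime_power_mult_cancel[OF P] by blast+
  \<comment> \<open>A prime power has only the one divisor \<open>1\<close> prime to it, which \<open>D\<close> and its complement cannot
    both contain.\<close>
  have M: "M > 1"
  proof (rule ccontr)
    assume "\<not> M > 1"
    then have "M = 1" using Mpos by simp
    then have "d = e" using dM eM by simp
    then show False using d e by simp
  qed
  have "ICG_eigenvalue n D j \<ge> - (real n / real P) + real P ^ (a - 1)" for j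
    unfolding bound using ICG_eigenvalue_ge[OF P n a M PM larger assms(6) eM] e by simp
  moreover have "ICG_eigenvalue n D j = - (real n / real P) + real P ^ (a - 1)"
    if D: "D = {d \<in> proper_divisors n. \<not> P dvd d} - {n div P ^ a}"
      and j: "j \<in> {1..n - 1}" "n div P dvd j" for j
  proof -
    have "\<not> n dvd j" using j(1) by (auto dest: dvd_imp_le)
    moreover have "M dvd j" using j(2) nP dvd_mult_right by metis
    moreover have "coprime (P ^ a) M" using P PM by (simp add: prime_imp_coprime_nat)
    ultimately have "\<not> P ^ a dvd j" using n divides_mult by metis
    moreover have "n div P ^ a = M" using n Ppos by simp
    ultimately show ?thesis
      unfolding bound using ICG_eigenvalue_all_coprime_but_one[OF P n a Mpos PM] D j(2) nP by simp
  qed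
  moreover have "ICG_eigenvalue n D j = - (real n / real P) + real P ^ (a - 1)"
    if n3: "n = 2 ^ a * 3" and D: "D = (\<lambda>i. 2 ^ i) ` {1..a} \<union> {3}"
      and j: "exactly_divides 2 (a - 1) j" "\<not> 3 dvd j" for j
  proof -
    have "2 dvd n" using n3 a by simp
    then have "2 dvd P ^ a * M" unfolding n .
    then have "2 dvd P \<or> 2 dvd M" by (meson prime_dvd_mult_iff prime_dvd_power two_is_prime_nat)
    then have "2 dvd P" using larger[of 2] prime_ge_2_nat[OF P] by auto
    then have "P = 2" using primes_dvd_imp_eq[OF two_is_prime_nat P] by simp
    moreover have "ICG_eigenvalue n D j = - (2 ^ a)"
      using ICG_eigenvalue_two_power_times_three[OF a n3 D] j a by (simp add: exactly_divides_def)
    ultimately show ?thesis using n3 a by (cases a) auto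
  qed
  ultimately show ?thesis unfolding P_def a_def by blast
qed

end
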